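(* Let $n\ge1$ be an integer and let $u(x,t)$ be the rational solution of the KdV equation $u_t=6uu_x-u_{xxx}$ with $u(x,0)=n(n+1)/x^2$, written in the form $$u(x,t)=2\sum_{q=1}^{n(n+1)/2}\frac{1}{(x-x_q(t))^2},\qquad x_q(t)=a_q t^{1/3},\quad a_q\in\mathbb C.$$ Then exactly $l_n=\left[\frac{n+1}{2}\right]$ of the poles $x_q(t)$ remain real for real $t\ne0$, i.e. exactly $l_n$ of the numbers $a_1,\dots,a_{n(n+1)/2}$ are real. This number is exactly equal to the number of coefficients $a_{k}$ standing at negative powers of $y$ in a principal part $\sum_{k=0}^{n}a_{k}/y^{n-2k}$.
   Context: $[\cdot]$ denotes the integer part and $t^{1/3}$ is the real cube root for real $t$. It is well known that the KdV solution with this initial value is rational in $x$ and has the displayed form. The sum $\sum_{k=0}^{n}a_k/y^{n-2k}$, $y=x-x_j$, is the general form of the principal part, at a singular point $x_j$ of order $n_j=n$, of functions in the function space considered in the paper. *)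

theory Defs
  imports "HOL-Analysis.Analysis"
begin

(* On D, u has a t-derivative and three iterated x-derivatives (the former along the real line,
   the latter complex) and satisfies u_t = 6 u u_x - u_xxx.  Intended for sets D whose slices in x
   and in t are open, so that the derivatives are determined by the values of u on D. *)
definition kdv_solution_on ::
    "(complex \<times> real) set \<Rightarrow> (complex \<Rightarrow> real \<Rightarrow> complex) \<Rightarrow> bool" where
  "kdv_solution_on D u \<longleftrightarrow>
     (\<exists>u_t u_x u_xx u_xxx :: complex \<Rightarrow> real \<Rightarrow> complex. \<forall>(x, t)\<in>D.
        ((\<lambda>s. u x s) has_vector_derivative u_t x t) (at t) \<and>
        ((\<lambda>z. u z t) has_field_derivative u_x x t) (at x) \<and>
        ((\<lambda>z. u_x z t) has_field_derivative u_xx x t) (at x) \<and>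
        ((\<lambda>z. u_xx z t) has_field_derivative u_xxx x t) (at x) \<and>
        u_t x t = 6 * u x t * u_x x t - u_xxx x t)"

(* The HOL root of odd order is the real root also for negative arguments. *)
definition kdv_pole :: "(nat \<Rightarrow> complex) \<Rightarrow> nat \<Rightarrow> real \<Rightarrow> complex" where
  "kdv_pole a q t = a q * complex_of_real (root 3 t)"

definition pp_exponent :: "nat \<Rightarrow> nat \<Rightarrow> int" where
  "pp_exponent n k = - (int n - 2 * int k)"

definition principal_part :: "nat \<Rightarrow> (nat \<Rightarrow> complex) \<Rightarrow> complex \<Rightarrow> complex" where
  "principal_part n c y = (\<Sum>k=0..n. c k / y powi (int n - 2 * int k))"

lemma principal_part_eq_powers:
  "principal_part n c y = (\<Sum>k=0..n. c k * y powi pp_exponent n k)"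
  by (simp only: principal_part_def pp_exponent_def power_int_minus divide_inverse)

end

theory Submission
  imports Defs "HOL-Computational_Algebra.Polynomial_Factorial" "HOL-Computational_Algebra.Field_as_Ring"
begin

text \<open>
  At time 1 the solution is \<open>-2 (log p)''\<close> for the monic polynomial \<open>p = \<Prod>q. (z - a q)\<close>. Integrating
  the similarity-reduced KdV equation once turns it into a quadratic differential equation for \<open>p\<close>.
  Among the monic polynomials of a given degree it has at most one solution, because the operator
  multiplies the leading coefficient of a difference by the square of the drop in degree.

  For the triangular degrees the solutions are, up to scaling, the Yablonskii--Vorob'ev polynomials
  \<open>P n\<close>. They are constructed by the Toda recursion
  \<open>P (n+1) P (n-1) = z (P n)\<^sup>2 - 12 (P n (P n)'' - ((P n)')\<^sup>2)\<close>, and they satisfy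
  \<open>(P (n+1))' P (n-1) - P (n+1) (P (n-1))' = (2n+1) (P n)\<^sup>2\<close>. Hence the rational function
  \<open>P (n+1) / P (n-1)\<close>, which grows like an odd power of \<open>z\<close>, increases on every interval between its
  real poles. So its real zeros and poles interlace and it has one zero more than poles: going from
  \<open>n - 1\<close> to \<open>n + 1\<close> adds exactly one real root.
\<close>

section \<open>Bilinear identities\<close>

text \<open>
  With Hirota's derivative \<open>D\<close>, the first two are \<open>D\<^sup>2 g \<cdot> f\<close> and \<open>(3 D\<^sup>3 - z D + n) g \<cdot> f\<close>: the
  bilinear form of the second Painleve equation for \<open>(log (g / f))'\<close>. The third, divided by \<open>p\<^sup>2\<close>, is
  \<open>(z L)' - 18 (L')\<^sup>2 - 3 L^(3)\<close> for \<open>L = p' / p\<close>.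
\<close>

definition hirota2 :: "'a::idom poly \<Rightarrow> 'a poly \<Rightarrow> 'a poly" where
  "hirota2 g f = pderiv (pderiv g) * f - 2 * pderiv g * pderiv f + g * pderiv (pderiv f)"

definition hirota3 :: "nat \<Rightarrow> 'a::idom poly \<Rightarrow> 'a poly \<Rightarrow> 'a poly" where
  "hirota3 n g f = 3 * (pderiv (pderiv (pderiv g)) * f - 3 * pderiv (pderiv g) * pderiv f
      + 3 * pderiv g * pderiv (pderiv f) - g * pderiv (pderiv (pderiv f)))
    - [:0, 1:] * (pderiv g * f - g * pderiv f) + of_nat n * g * f"

definition kdv_bilinear :: "'a::idom poly \<Rightarrow> 'a poly" where
  "kdv_bilinear p = p * pderiv p + [:0, 1:] * (p * pderiv (pderiv p) - pderiv p ^ 2)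
     - 3 * p * pderiv (pderiv (pderiv (pderiv p)))
     + 12 * pderiv p * pderiv (pderiv (pderiv p)) - 9 * pderiv (pderiv p) ^ 2"

definition toda :: "'a::idom poly \<Rightarrow> 'a poly" where
  "toda g = [:0, 1:] * g ^ 2 - 12 * (g * pderiv (pderiv g) - pderiv g ^ 2)"

lemma pderiv_X: "pderiv ([:0, 1:] :: 'a::idom poly) = 1"
  by (simp add: pderiv_pCons one_pCons)

lemmas pderiv_rules = pderiv_mult pderiv_add pderiv_diff pderiv_minus power2_eq_square
   pderiv_X pderiv_of_nat pderiv_numeral

text \<open>With \<open>w = (log (g / f))'\<close>, the condition \<open>hirota2 g f = 0\<close>
  makes \<open>-2 (log g)''\<close> and \<open>-2 (log f)''\<close> the Miura images
  \<open>w^2 - w'\<close> and \<open>w^2 + w'\<close>. Hence a solution at one end of a pair yields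
  one at the other end.\<close>

lemma kdv_bilinear_transfer:
  fixes f g :: "'a::idom poly"
  assumes C: "hirota2 g f = 0" and D: "hirota3 n g f = 0"
  shows "kdv_bilinear g * f ^ 2 = kdv_bilinear f * g ^ 2"
proof -
  let ?W = "pderiv g * f - g * pderiv f"
  \<comment> \<open>\<open>?W / (g f)\<close> is the Painleve transcendent \<open>(log (g / f))'\<close>\<close>
  have "kdv_bilinear g * f ^ 2 - kdv_bilinear f * g ^ 2 =
     - (g * f * pderiv (hirota3 n g f) - pderiv (g * f) * hirota3 n g f)
     + 9 * (?W * pderiv (hirota2 g f) - pderiv ?W * hirota2 g f)"
    unfolding kdv_bilinear_def hirota2_def hirota3_def pderiv_rules
    by algebra
  then show ?thesis by (simp add: C D)
qed

text \<open>This is the Wronskian identity before \<open>f\<close> is known to divide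
  \<open>toda g\<close>: for \<open>toda g = h * f\<close> the left side is \<open>f\<close> times
  the Wronskian of \<open>h\<close> and \<open>f\<close>. The divisibility itself is also read off
  from it.\<close>

lemma toda_wronskian:
  fixes f g :: "'a::idom poly"
  assumes C: "hirota2 g f = 0" and D: "hirota3 n g f = 0"
  shows "pderiv (toda g) * f - 2 * toda g * pderiv f = of_nat (2 * n + 1) * g ^ 2 * f"
proof -
  have n: "of_nat (2 * n + 1) = (2 * of_nat n + 1 :: 'a poly)" by simp
  have "pderiv (toda g) * f - 2 * toda g * pderiv f - of_nat (2 * n + 1) * g ^ 2 * f =
     - 2 * g * hirota3 n g f - 6 * g * pderiv (hirota2 g f) + 12 * pderiv g * hirota2 g f"
    unfolding toda_def hirota2_def hirota3_def n pderiv_rules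
    by algebra
  then show ?thesis by (simp add: C D)
qed

text \<open>The Wronskian relation and its derivative express \<open>f * h'\<close> and
  \<open>f * h''\<close> without derivatives of \<open>h\<close>; the terms in \<open>m\<close> then
  cancel.\<close>

lemma hirota2_step:
  fixes f g h :: "'a::idom poly"
  assumes C: "hirota2 g f = 0" and f: "f \<noteq> 0"
    and B: "pderiv h * f - h * pderiv f = m * g ^ 2" and m: "pderiv m = 0"
  shows "hirota2 h g = 0"
proof -
  have B1: "pderiv (pderiv h) * f - h * pderiv (pderiv f) = 2 * m * g * pderiv g"
    using arg_cong[OF B, of pderiv] by (simp add: pderiv_rules m algebra_simps)
  have "f * hirota2 h g = h * hirota2 g f"
    unfolding hirota2_def using B B1 by algebra
  then show ?thesis using C f by simp
qed

text \<open>The same elimination, now with two derivatives of the Wronskian relation. The second one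
  still contains \<open>h''\<close>, hence the factor \<open>f ^ 2\<close>.\<close>

lemma hirota3_step:
  fixes f g h :: "'a::idom poly"
  assumes C: "hirota2 g f = 0" and D: "hirota3 n g f = 0" and f: "f \<noteq> 0"
    and A: "h * f = toda g"
    and B: "pderiv h * f - h * pderiv f = of_nat (2 * n + 1) * g ^ 2"
  shows "hirota3 (Suc n) h g = 0"
proof -
  define m :: "'a poly" where "m = 2 * of_nat n + 1"
  have m: "pderiv m = 0" by (simp add: m_def pderiv_rules)
  have B: "pderiv h * f - h * pderiv f = m * g ^ 2" using B by (simp add: m_def)
  have B1: "pderiv (pderiv h) * f - h * pderiv (pderiv f) = 2 * m * g * pderiv g"
    using arg_cong[OF B, of pderiv] by (simp add: pderiv_rules m algebra_simps)
  have B2: "pderiv (pderiv (pderiv h)) * f + pderiv (pderiv h) * pderiv f - pderiv h * pderiv (pderiv f)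
      - h * pderiv (pderiv (pderiv f)) = 2 * m * (pderiv g ^ 2 + g * pderiv (pderiv g))"
    using arg_cong[OF B1, of pderiv] by (simp add: pderiv_rules m algebra_simps)
  have S: "of_nat (Suc n) = m - of_nat n" by (simp add: m_def)
  define h3 where "h3 = pderiv (pderiv (pderiv h))"
  define h2 where "h2 = pderiv (pderiv h)"
  define h1 where "h1 = pderiv h"
  have "f ^ 2 * hirota3 (Suc n) h g = - h * f * hirota3 n g f + 3 * m * g ^ 2 * hirota2 g f
     + m * f * g * (h * f - toda g)"
    unfolding hirota2_def hirota3_def toda_def S using B B1 B2
    unfolding h3_def[symmetric] h2_def[symmetric] h1_def[symmetric]
    by algebra
  then show ?thesis using C D A f by simp
qed

section \<open>Interlacing of real roots\<close>

text \<open>Sending each element of \<open>B\<close> except the largest to the smallest element of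
  \<open>A\<close> above it is strictly increasing, hence injective.\<close>

lemma card_le_Suc_card_if_separated:
  fixes A B :: "'a::linorder set"
  assumes A: "finite A" and B: "finite B"
    and sep: "\<And>x y. x \<in> B \<Longrightarrow> y \<in> B \<Longrightarrow> x < y \<Longrightarrow> \<exists>a\<in>A. x < a \<and> a < y"
  shows "card B \<le> card A + 1"
proof (cases "B = {}")
  case False
  define \<phi> where "\<phi> b = Min {a \<in> A. b < a}" for b
  have ne: "{a \<in> A. b < a} \<noteq> {}" if "b \<in> B - {Max B}" for b
  proof -
    have "b < Max B" using that B by (simp add: order.not_eq_order_implies_strict)
    then show ?thesis using sep[of b "Max B"] that B False by auto
  qed
  have in_A: "\<phi> b \<in> A \<and> b < \<phi> b" if "b \<in> B - {Max B}" for b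
    using Min_in[OF _ ne[OF that]] A by (auto simp: \<phi>_def)
  have less: "\<phi> b < \<phi> b'" if b: "b \<in> B - {Max B}" "b' \<in> B - {Max B}" "b < b'" for b b'
  proof -
    obtain a where a: "a \<in> A" "b < a" "a < b'" using sep[of b b'] b by auto
    have "\<phi> b \<le> a" unfolding \<phi>_def using a A by (intro Min_le) auto
    then show ?thesis using a in_A[OF b(2)] by auto
  qed
  have "inj_on \<phi> (B - {Max B})"
  proof (rule inj_onI)
    fix b b' assume "b \<in> B - {Max B}" "b' \<in> B - {Max B}" "\<phi> b = \<phi> b'"
    then show "b = b'" using less[of b b'] less[of b' b] by (cases b b' rule: linorder_cases) auto
  qed
  then have "card (B - {Max B}) \<le> card A"
    using in_A A by (intro card_inj_on_le[of \<phi>]) auto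
  then show ?thesis using B False by (simp add: card_Diff_singleton)
qed simp

text \<open>Without a zero of \<open>q\<close>, the quotient \<open>p / q\<close> has derivative
  \<open>- m g^2 / q^2\<close> and cannot increase. The assumed inequality then forces it to be
  constant, and the Wronskian would vanish.\<close>

lemma root_between_if_quotient_le:
  fixes p q g :: "real poly"
  assumes W: "pderiv q * p - q * pderiv p = of_nat m * g ^ 2" and m: "m > 0" and g: "g \<noteq> 0"
    and xy: "x < y" and x: "poly q x \<noteq> 0" and y: "poly q y \<noteq> 0"
    and le: "poly p x / poly q x \<le> poly p y / poly q y"
  shows "\<exists>z. x < z \<and> z < y \<and> poly q z = 0"
proof (rule ccontr)
  assume "\<not> ?thesis"
  then have nz: "poly q z \<noteq> 0" if "x \<le> z" "z \<le> y" for z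
    using that x y by (cases "z = x \<or> z = y") (auto simp: order_less_le)
  define \<phi> where "\<phi> z = poly p z / poly q z" for z
  have D: "(\<phi> has_real_derivative - (m * poly g z ^ 2 / poly q z ^ 2)) (at z)"
    if "x \<le> z" "z \<le> y" for z
  proof -
    have "(\<phi> has_real_derivative
        (poly (pderiv p) z * poly q z - poly p z * poly (pderiv q) z) / (poly q z * poly q z)) (at z)"
      unfolding \<phi>_def by (rule DERIV_divide) (use nz that in \<open>auto intro: poly_DERIV\<close>)
    moreover have "poly (pderiv q) z * poly p z - poly q z * poly (pderiv p) z = m * poly g z ^ 2"
      using arg_cong[OF W, of "\<lambda>r. poly r z"] by (simp add: of_nat_poly)
    ultimately show ?thesis
      by (simp add: power2_eq_square algebra_simps divide_simps)
  qed
  have anti: "\<phi> v \<le> \<phi> u" if "x \<le> u" "u \<le> v" "v \<le> y" for u v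
  proof (rule DERIV_nonpos_imp_nonincreasing[OF that(2)])
    fix z assume "u \<le> z" "z \<le> v"
    then show "\<exists>d. (\<phi> has_real_derivative d) (at z) \<and> d \<le> 0"
      using D[of z] that by (intro exI[of _ "- (m * poly g z ^ 2 / poly q z ^ 2)"]) auto
  qed
  have const: "\<phi> z = \<phi> x" if "x \<le> z" "z \<le> y" for z
    using anti[of x z] anti[of z y] le that xy by (fastforce simp: \<phi>_def)
  \<comment> \<open>Two polynomials that agree on a whole interval are equal.\<close>
  have "p = smult (\<phi> x) q"
  proof (rule ccontr)
    assume "p \<noteq> smult (\<phi> x) q"
    then have "finite {z. poly (p - smult (\<phi> x) q) z = 0}" by (intro poly_roots_finite) auto
    moreover have "{x..y} \<subseteq> {z. poly (p - smult (\<phi> x) q) z = 0}"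
    proof
      fix z assume "z \<in> {x..y}"
      then show "z \<in> {z. poly (p - smult (\<phi> x) q) z = 0}"
        using const[of z] nz[of z] by (auto simp: \<phi>_def field_simps)
    qed
    ultimately show False using xy finite_subset infinite_Icc by blast
  qed
  then have "of_nat m * g ^ 2 = 0" using W by (simp add: pderiv_smult algebra_simps)
  then show False using m g by simp
qed

lemma real_poly_pos_at_top:
  fixes p :: "real poly"
  assumes "lead_coeff p > 0"
  shows "eventually (\<lambda>x. poly p x > 0) at_top"
  using poly_pinfty_gt_lc[OF assms] assms unfolding eventually_at_top_linorder
  by (meson dual_order.strict_trans1)

lemma real_poly_neg_at_bot:
  fixes p :: "real poly"
  assumes p: "lead_coeff p > 0" and odd: "odd (degree p)"
  shows "eventually (\<lambda>x. poly p x < 0) at_bot"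
proof -
  have "lead_coeff (- pcompose p [:0, -1:]) > 0"
    using p odd by (simp add: lead_coeff_comp)
  from real_poly_pos_at_top[OF this] show ?thesis
    by (simp add: at_bot_mirror eventually_filtermap poly_pcompose)
qed

text \<open>Two zeros of \<open>h\<close> enclose a zero of \<open>f\<close>. Conversely, the zeros
  of \<open>f\<close> together with one point on each side of them are separated by zeros of
  \<open>h\<close>, which gives the other inequality.\<close>

lemma card_roots_Suc:
  fixes f g h :: "real poly"
  assumes W: "pderiv h * f - h * pderiv f = of_nat m * g ^ 2" and m: "m > 0" and g: "g \<noteq> 0"
    and cop: "coprime h f" and f: "lead_coeff f > 0" and h: "lead_coeff h > 0"
    and odd: "odd (degree f + degree h)"
  shows "card {x. poly h x = 0} = card {x. poly f x = 0} + 1"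
proof (rule antisym)
  let ?H = "{x. poly h x = 0}" and ?F = "{x. poly f x = 0}"
  have f0: "f \<noteq> 0" and h0: "h \<noteq> 0" using f h by auto
  have finF: "finite ?F" and finH: "finite ?H" using f0 h0 by (simp_all add: poly_roots_finite)
  have dis: "poly f x \<noteq> 0" if "poly h x = 0" for x
  proof
    assume "poly f x = 0"
    then have "[:-x, 1:] dvd f" "[:-x, 1:] dvd h" using that by (simp_all add: poly_eq_0_iff_dvd)
    then have "is_unit [:-x, 1:]" using cop coprime_common_divisor by blast
    then show False by (simp add: is_unit_iff_degree)
  qed
  show "card ?H \<le> card ?F + 1"
  proof (rule card_le_Suc_card_if_separated[OF finF finH])
    fix x y assume xy: "x \<in> ?H" "y \<in> ?H" "x < y"
    \<comment> \<open>\<open>- h / f\<close> decreases just as \<open>f / h\<close> does\<close>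
    have "pderiv f * (- h) - f * pderiv (- h) = of_nat m * g ^ 2"
      using W by (simp add: pderiv_minus algebra_simps)
    from root_between_if_quotient_le[OF this m g xy(3)] show "\<exists>a\<in>?F. x < a \<and> a < y"
      using xy dis by auto
  qed
  \<comment> \<open>The signs of \<open>hi\<close> and \<open>lo\<close> ensure
    \<open>lo < hi\<close> even when \<open>f\<close> has no real zero.\<close>
  have "eventually (\<lambda>x. poly f x > 0 \<and> poly h x > 0 \<and> (\<forall>y\<in>?F. y < x) \<and> 0 < x) at_top"
    using finF f h
    by (intro eventually_conj real_poly_pos_at_top eventually_gt_at_top eventually_ball_finite) auto
  from eventually_happens'[OF trivial_limit_at_top_linorder this]
  obtain hi where hi: "poly f hi > 0" "poly h hi > 0" "\<forall>y\<in>?F. y < hi" "0 < hi"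
    by blast
  have below: "eventually (\<lambda>x. x < c) at_bot" for c :: real
    by (auto simp: eventually_at_bot_dense)
  \<comment> \<open>The odd total degree makes \<open>f\<close> and \<open>h\<close> differ in sign
    far to the left, so \<open>f / h\<close> is negative at \<open>lo\<close> and positive at
    \<open>hi\<close>.\<close>
  have "odd (degree (f * h))" "lead_coeff (f * h) > 0"
    using odd f h f0 h0 by (simp_all add: degree_mult_eq coeff_mult_degree_sum)
  then have "eventually (\<lambda>x. poly (f * h) x < 0 \<and> (\<forall>y\<in>?F. x < y) \<and> x < 0) at_bot"
    using finF by (intro eventually_conj real_poly_neg_at_bot eventually_ball_finite) (auto simp: below)
  from eventually_happens'[OF trivial_limit_at_bot_linorder this]
  obtain lo where lo: "poly f lo * poly h lo < 0" "\<forall>y\<in>?F. lo < y" "lo < 0"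
    unfolding poly_mult by blast
  have fin: "finite (insert lo (insert hi ?F))" using finF by simp
  have "card (insert lo (insert hi ?F)) \<le> card ?H + 1"
  proof (rule card_le_Suc_card_if_separated[OF finH fin])
    fix x y assume x: "x \<in> insert lo (insert hi ?F)" and y: "y \<in> insert lo (insert hi ?F)" and xy: "x < y"
    have "x \<noteq> hi" using y xy hi lo by auto
    then have "x = lo \<or> poly f x = 0" using x by auto
    then have *: "poly f x / poly h x \<le> 0" "poly h x \<noteq> 0"
      using lo(1) dis by (auto simp: divide_le_0_iff mult_less_0_iff)
    have "y \<noteq> lo" using x xy hi lo by auto
    then have "y = hi \<or> poly f y = 0" using y by auto
    then have **: "0 \<le> poly f y / poly h y" "poly h y \<noteq> 0"
      using hi dis by (auto simp: zero_le_divide_iff)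
    show "\<exists>a\<in>?H. x < a \<and> a < y"
      using root_between_if_quotient_le[OF W m g xy *(2) **(2)] *(1) **(1) by auto
  qed
  moreover have "lo \<notin> insert hi ?F" "hi \<notin> ?F" using hi lo by auto
  then have "card (insert lo (insert hi ?F)) = card ?F + 2"
    using finF by simp
  ultimately show "card ?F + 1 \<le> card ?H" by simp
qed

section \<open>The polynomials with real coefficients\<close>

lemma degree_toda:
  fixes g :: "real poly"
  assumes "lead_coeff g = 1"
  shows "degree (toda g) = 2 * degree g + 1" and "lead_coeff (toda g) = 1"
proof -
  have g0: "g \<noteq> 0" using assms by auto
  define r where "r = - (12 * (g * pderiv (pderiv g) - pderiv g ^ 2))"
  have q: "degree ([:0, 1:] * g ^ 2) = 2 * degree g + 1"
    using g0 by (simp add: degree_mult_eq degree_power_eq)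
  have mq: "lead_coeff ([:0, 1:] * g ^ 2) = 1"
    using assms by (simp only: lead_coeff_mult lead_coeff_power) simp
  have "degree r \<le> degree (g * pderiv (pderiv g) - pderiv g ^ 2)"
    unfolding r_def degree_minus
    by (metis add_0 degree_mult_le degree_numeral)
  also have "\<dots> \<le> 2 * degree g"
  proof (rule degree_diff_le)
    show "degree (g * pderiv (pderiv g)) \<le> 2 * degree g"
      using degree_mult_le[of g "pderiv (pderiv g)"] degree_pderiv[of g]
        degree_pderiv[of "pderiv g"] by linarith
    show "degree ((pderiv g)\<^sup>2) \<le> 2 * degree g"
      using degree_power_le[of "pderiv g" 2] degree_pderiv[of g] by linarith
  qed
  finally have r: "degree r < degree ([:0, 1:] * g ^ 2)" using q by simp
  have t: "toda g = [:0, 1:] * g ^ 2 + r" by (simp add: toda_def r_def)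
  show "degree (toda g) = 2 * degree g + 1"
    unfolding t degree_add_eq_left[OF r] by (rule q)
  show "lead_coeff (toda g) = 1"
    using mq r unfolding t degree_add_eq_left[OF r] coeff_add by (simp add: coeff_eq_0)
qed

text \<open>Modulo \<open>f\<close>, the identity \<open>toda_wronskian\<close> leaves
  \<open>2 * toda g * pderiv f\<close>, and \<open>pderiv f\<close> is invertible modulo
  \<open>f\<close>.\<close>

lemma toda_quotient:
  fixes f g :: "real poly"
  assumes C: "hirota2 g f = 0" and D: "hirota3 n g f = 0" and f: "f \<noteq> 0"
    and sqf: "coprime f (pderiv f)"
  obtains h where "h * f = toda g" "pderiv h * f - h * pderiv f = of_nat (2 * n + 1) * g ^ 2"
proof -
  note T = toda_wronskian[OF C D]
  have "f dvd pderiv (toda g) * f - of_nat (2 * n + 1) * g ^ 2 * f"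
    by (intro dvd_diff dvd_triv_right)
  also have "\<dots> = smult 2 (toda g) * pderiv f"
    using T by (simp add: algebra_simps numeral_poly)
  finally have "f dvd smult 2 (toda g)"
    using sqf coprime_dvd_mult_left_iff by blast
  then have "f dvd toda g" by (simp add: dvd_smult_iff)
  then obtain h where h: "toda g = h * f" by (metis dvd_div_mult_self)
  have "f * (pderiv h * f - h * pderiv f) = f * (of_nat (2 * n + 1) * g ^ 2)"
    using T unfolding h pderiv_mult by (simp add: algebra_simps)
  then have "pderiv h * f - h * pderiv f = of_nat (2 * n + 1) * g ^ 2"
    using f mult_left_cancel by blast
  then show ?thesis using h that by metis
qed

text \<open>A common divisor of \<open>h\<close> and \<open>g\<close> divides
  \<open>12 * (pderiv g)^2\<close>, so it is a unit. A common divisor of \<open>h\<close> with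
  \<open>f\<close> or with \<open>pderiv h\<close> divides the Wronskian, a nonzero constant times
  \<open>g ^ 2\<close>, and \<open>h\<close> is coprime to that.\<close>

lemma coprime_toda_quotient:
  fixes f g h :: "real poly"
  assumes A: "h * f = toda g" and B: "pderiv h * f - h * pderiv f = of_nat (2 * n + 1) * g ^ 2"
    and sqf: "coprime g (pderiv g)"
  shows "coprime h f" "coprime h (pderiv h)"
proof -
  have g2: "is_unit d" if "d dvd g" "d dvd c * pderiv g ^ 2" "is_unit c" for c d
  proof -
    have "coprime g (pderiv g ^ 2)" using sqf by simp
    moreover have "d dvd pderiv g ^ 2" using that by (simp only: dvd_mult_unit_iff')
    ultimately show ?thesis by (rule coprime_common_divisor[OF _ that(1)])
  qed
  have "coprime h g"
  proof (rule coprimeI)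
    fix d assume d: "d dvd h" "d dvd g"
    then have "d dvd toda g - g * ([:0, 1:] * g - 12 * pderiv (pderiv g))"
      by (intro dvd_diff) (auto simp: A[symmetric])
    also have "\<dots> = 12 * pderiv g ^ 2"
      unfolding toda_def by algebra
    finally have "d dvd 12 * pderiv g ^ 2" .
    moreover have "is_unit (12 :: real poly)"
      unfolding numeral_poly by (simp add: is_unit_const_poly_iff dvd_field_iff)
    ultimately show "is_unit d" by (rule g2[OF d(2)])
  qed
  then have hg: "is_unit d" if "d dvd h" "d dvd pderiv h * f - h * pderiv f" for d
  proof -
    have "is_unit (of_nat (2 * n + 1) :: real poly)"
      unfolding of_nat_poly by (simp add: is_unit_const_poly_iff dvd_field_iff del: of_nat_Suc of_nat_add)
    then have "d dvd g ^ 2" using that(2) unfolding B by (simp only: dvd_mult_unit_iff')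
    moreover have "coprime h (g ^ 2)" using \<open>coprime h g\<close> by simp
    ultimately show ?thesis using that(1) coprime_common_divisor by blast
  qed
  show "coprime h f"
    by (rule coprimeI) (rule hg; simp)
  show "coprime h (pderiv h)"
    by (rule coprimeI) (rule hg; simp)
qed

section \<open>The sequence of Yablonskii--Vorob'ev polynomials\<close>

definition triangular :: "nat \<Rightarrow> nat" where "triangular n = n * (n + 1) div 2"

lemma triangular_0: "triangular 0 = 0"
  by (simp add: triangular_def)

lemma triangular_Suc: "triangular (Suc n) = triangular n + Suc n"
proof -
  have "Suc n * (Suc n + 1) = n * (n + 1) + Suc n * 2" by (simp add: algebra_simps)
  then show ?thesis unfolding triangular_def by simp
qed

text \<open>The recursion has three terms, so the induction carries consecutive pairs, starting from
  \<open>1\<close> and \<open>z\<close>. Both root counts are carried because one real root is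
  gained over two indices.\<close>

lemma tau_pair_exists:
  "\<exists>f g :: real poly. lead_coeff f = 1 \<and> lead_coeff g = 1 \<and> degree f = triangular n \<and>
     degree g = triangular (Suc n) \<and> coprime f (pderiv f) \<and> coprime g (pderiv g) \<and>
     hirota2 g f = 0 \<and> hirota3 (Suc n) g f = 0 \<and> kdv_bilinear f = 0 \<and> kdv_bilinear g = 0 \<and>
     card {x. poly f x = 0} = (n + 1) div 2 \<and> card {x. poly g x = 0} = (Suc n + 1) div 2"
proof (induction n)
  case 0
  define X :: "real poly" where "X = [:0, 1:]"
  have X: "lead_coeff X = 1" "degree X = 1" "pderiv X = 1" "{x. poly X x = 0} = {0}"
    by (auto simp: X_def pderiv_X)
  have "hirota2 X 1 = 0" "hirota3 (Suc 0) X 1 = 0" "kdv_bilinear X = 0" "kdv_bilinear (1 :: real poly) = 0"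
    unfolding hirota2_def hirota3_def kdv_bilinear_def X_def[symmetric] X(3)
    by (simp_all add: power2_eq_square)
  then show ?case using X by - (rule exI[of _ 1], rule exI[of _ X], simp add: triangular_0 triangular_Suc)
next
  case (Suc n)
  then obtain f g :: "real poly" where f: "lead_coeff f = 1" and g: "lead_coeff g = 1"
    and df: "degree f = triangular n" and dg: "degree g = triangular (Suc n)"
    and sf: "coprime f (pderiv f)" and sg: "coprime g (pderiv g)"
    and C: "hirota2 g f = 0" and D: "hirota3 (Suc n) g f = 0"
    and kf: "kdv_bilinear f = 0" and kg: "kdv_bilinear g = 0"
    and rf: "card {x. poly f x = 0} = (n + 1) div 2" and rg: "card {x. poly g x = 0} = (Suc n + 1) div 2"
    by blast
  have f0: "f \<noteq> 0" and g0: "g \<noteq> 0" using f g by auto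
  obtain h where A: "h * f = toda g" and B: "pderiv h * f - h * pderiv f = of_nat (2 * Suc n + 1) * g ^ 2"
    using toda_quotient[OF C D f0 sf] by blast
  have h0: "h \<noteq> 0" using A degree_toda(1)[OF g] by force
  have C': "hirota2 h g = 0"
    by (rule hirota2_step[OF C f0 B]) (rule pderiv_of_nat)
  have D': "hirota3 (Suc (Suc n)) h g = 0"
    by (rule hirota3_step[OF C D f0 A B])
  have "kdv_bilinear h * g ^ 2 = 0"
    using kdv_bilinear_transfer[OF C' D'] kg by simp
  then have kh: "kdv_bilinear h = 0" using g0 by simp
  have h: "lead_coeff h = 1"
    using degree_toda(2)[OF g] f unfolding A[symmetric] lead_coeff_mult by simp
  have "degree h + degree f = 2 * degree g + 1"
    using degree_toda(1)[OF g] f0 h0 unfolding A[symmetric] by (simp add: degree_mult_eq)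
  then have dh: "degree h = triangular (Suc (Suc n))"
    using df dg by (simp add: triangular_Suc)
  have odd: "odd (degree f + degree h)"
    using \<open>degree h + degree f = 2 * degree g + 1\<close> by presburger
  note cop = coprime_toda_quotient[OF A B sg]
  have "card {x. poly h x = 0} = card {x. poly f x = 0} + 1"
    by (rule card_roots_Suc[OF B _ g0 cop(1)]) (use f h odd in auto)
  then have rh: "card {x. poly h x = 0} = (Suc (Suc n) + 1) div 2" using rf by simp
  show ?case
    by (rule exI[of _ g], rule exI[of _ h], intro conjI) (fact g h dg dh sg cop(2) C' D' kg kh rg rh)+
qed

section \<open>Uniqueness\<close>

definition euler_deriv :: "nat \<Rightarrow> 'a::idom poly \<Rightarrow> 'a poly" where
  "euler_deriv k p = [:0, 1:] ^ k * (pderiv ^^ k) p"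

lemma coeff_X_power_mult:
  "coeff ([:0, 1:] ^ k * p) i = (if i < k then 0 else coeff p (i - k))" for p :: "'a::idom poly"
proof -
  have "[:0, 1:] ^ k = monom (1 :: 'a) k" by (simp add: monom_altdef)
  then show ?thesis by (simp add: coeff_monom_mult not_less)
qed

text \<open>The Pochhammer symbol rising from \<open>i - k + 1\<close> is the falling factorial of
  \<open>i\<close> with \<open>k\<close> factors.\<close>

lemma coeff_euler_deriv:
  "coeff (euler_deriv k p) i = (if i < k then 0 else pochhammer (of_nat (Suc (i - k))) k * coeff p i)"
  by (simp add: euler_deriv_def coeff_X_power_mult coeff_higher_pderiv)

lemma coeff_euler_deriv_1: "coeff (euler_deriv 1 p) i = of_nat i * coeff p i"
  by (cases i) (simp_all add: coeff_euler_deriv)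

lemma coeff_euler_deriv_2: "coeff (euler_deriv 2 p) i = of_nat i * (of_nat i - 1) * coeff p i"
proof (cases "i < 2")
  case True
  then have "i = 0 \<or> i = 1" by auto
  then show ?thesis by (auto simp: coeff_euler_deriv)
next
  case False
  then obtain j where "i = Suc (Suc j)" by (metis add_2_eq_Suc le_Suc_ex not_less)
  then show ?thesis by (simp add: coeff_euler_deriv pochhammer_Suc numeral_2_eq_2 algebra_simps)
qed

lemma degree_euler_deriv: "degree (euler_deriv k p) \<le> degree p"
  by (rule degree_le) (simp add: coeff_euler_deriv coeff_eq_0)

lemma degree_euler_deriv_mult:
  "degree p \<le> i \<Longrightarrow> degree q \<le> j \<Longrightarrow> degree (euler_deriv k p * euler_deriv l q) \<le> i + j"
  using degree_mult_le[of "euler_deriv k p" "euler_deriv l q"] degree_euler_deriv[of k p]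
    degree_euler_deriv[of l q] by linarith

lemma coeff_mult_add_bound:
  fixes p q :: "'a::idom poly"
  assumes "degree p \<le> i" "degree q \<le> j"
  shows "coeff (p * q) (i + j) = coeff p i * coeff q j"
proof (cases "degree p = i \<and> degree q = j")
  case True
  then show ?thesis using coeff_mult_degree_sum by blast
next
  case False
  then have "degree p < i \<or> degree q < j" using assms by auto
  moreover then have "degree (p * q) < i + j"
    using degree_mult_le[of p q] assms by linarith
  ultimately show ?thesis by (auto simp: coeff_eq_0)
qed

text \<open>
  Multiplying the \<open>k\<close>-th derivative by \<open>z^k\<close> keeps degrees at most that of \<open>p\<close>, without truncated
  subtraction; the quadratic equation then splits into a part of top degree and one that is lower
  by three.
\<close>

definition euler_quadratic :: "'a::idom poly \<Rightarrow> 'a poly \<Rightarrow> 'a poly" where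
  "euler_quadratic p q =
     euler_deriv 0 p * euler_deriv 1 q + euler_deriv 1 p * euler_deriv 0 q
     + euler_deriv 0 p * euler_deriv 2 q + euler_deriv 2 p * euler_deriv 0 q
     - 2 * (euler_deriv 1 p * euler_deriv 1 q)"

definition euler_quartic :: "'a::idom poly \<Rightarrow> 'a poly \<Rightarrow> 'a poly" where
  "euler_quartic p q =
     3 * (euler_deriv 0 p * euler_deriv 4 q + euler_deriv 4 p * euler_deriv 0 q)
     - 12 * (euler_deriv 1 p * euler_deriv 3 q + euler_deriv 3 p * euler_deriv 1 q)
     + 18 * (euler_deriv 2 p * euler_deriv 2 q)"

text \<open>The factor 2 comes from polarization: the symmetric bilinear forms are not halved, as
  \<open>'a\<close> need not allow division.\<close>

lemma kdv_bilinear_euler: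
  "2 * ([:0, 1:] ^ 4 * kdv_bilinear p) = [:0, 1:] ^ 3 * euler_quadratic p p - euler_quartic p p"
proof -
  have "euler_deriv 0 p = p" "euler_deriv 1 p = [:0, 1:] * pderiv p"
    "euler_deriv 2 p = [:0, 1:] ^ 2 * pderiv (pderiv p)"
    "euler_deriv 3 p = [:0, 1:] ^ 3 * pderiv (pderiv (pderiv p))"
    "euler_deriv 4 p = [:0, 1:] ^ 4 * pderiv (pderiv (pderiv (pderiv p)))"
    by (simp_all add: euler_deriv_def eval_nat_numeral)
  note e = this
  show ?thesis
    unfolding euler_quadratic_def euler_quartic_def kdv_bilinear_def e by algebra
qed

text \<open>A symmetric bilinear form satisfies \<open>B(p, p) - B(q, q) = B(p - q, p + q)\<close>,
  which turns a difference of two quadratic equations into one that is linear in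
  \<open>p - q\<close>.\<close>

lemma kdv_bilinear_diff_euler:
  "2 * ([:0, 1:] ^ 4 * (kdv_bilinear p - kdv_bilinear q)) =
     [:0, 1:] ^ 3 * euler_quadratic (p - q) (p + q) - euler_quartic (p - q) (p + q)"
proof -
  have d: "(pderiv ^^ k) (p - q) = (pderiv ^^ k) p - (pderiv ^^ k) q"
    "(pderiv ^^ k) (p + q) = (pderiv ^^ k) p + (pderiv ^^ k) q" for k
    by (induction k) (simp_all add: pderiv_diff pderiv_add)
  have "euler_deriv k (p - q) = euler_deriv k p - euler_deriv k q"
    "euler_deriv k (p + q) = euler_deriv k p + euler_deriv k q" for k
    by (simp_all add: euler_deriv_def d algebra_simps)
  note e = this
  show ?thesis
    using kdv_bilinear_euler[of p] kdv_bilinear_euler[of q]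
    unfolding euler_quadratic_def euler_quartic_def e by algebra
qed

lemma degree_euler_quadratic:
  assumes "degree p \<le> i" "degree q \<le> j"
  shows "degree (euler_quadratic p q) \<le> i + j"
proof -
  note d = degree_euler_deriv_mult[OF assms]
  have "degree (2 * (euler_deriv 1 p * euler_deriv 1 q)) \<le> i + j"
    using degree_mult_le[of 2 "euler_deriv 1 p * euler_deriv 1 q"] d[of 1 1] by simp
  then show ?thesis
    unfolding euler_quadratic_def by (intro degree_add_le degree_diff_le d)
qed

lemma degree_euler_quartic:
  assumes "degree p \<le> i" "degree q \<le> j"
  shows "degree (euler_quartic p q) \<le> i + j"
proof -
  note d = degree_euler_deriv_mult[OF assms]
  have n: "degree (numeral m * r) \<le> i + j" if "degree r \<le> i + j" for m and r :: "'a poly"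
    using degree_mult_le[of "numeral m" r] that by simp
  show ?thesis
    unfolding euler_quartic_def by (intro degree_add_le degree_diff_le d n)
qed

text \<open>On top coefficients the operators act as multiplications, and
  \<open>j + i + j (j - 1) + i (i - 1) - 2 i j = (j - i)^2\<close>.\<close>

lemma coeff_euler_quadratic:
  assumes p: "degree p \<le> i" and q: "degree q \<le> j"
  shows "coeff (euler_quadratic p q) (i + j) = (of_nat j - of_nat i) ^ 2 * coeff p i * coeff q j"
proof -
  have c: "coeff (euler_deriv k p * euler_deriv l q) (i + j)
      = coeff (euler_deriv k p) i * coeff (euler_deriv l q) j" for k l
    by (intro coeff_mult_add_bound order.trans[OF degree_euler_deriv] p q)
  have 0: "euler_deriv 0 r = r" for r :: "'a poly" by (simp add: euler_deriv_def)
  have 2: "2 * r = smult 2 r" for r :: "'a poly" by (simp add: numeral_poly)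
  show ?thesis
    unfolding euler_quadratic_def 2 coeff_add coeff_diff coeff_smult c
    unfolding coeff_euler_deriv_1 coeff_euler_deriv_2 0
    by (simp add: algebra_simps power2_eq_square)
qed

lemma kdv_bilinear_unique:
  fixes p q :: "'a::{idom, ring_char_0} poly"
  assumes p: "lead_coeff p = 1" and q: "lead_coeff q = 1" and deg: "degree p = degree q"
    and kp: "kdv_bilinear p = 0" and kq: "kdv_bilinear q = 0"
  shows "p = q"
proof (rule ccontr)
  assume "p \<noteq> q"
  define r where "r = p - q"
  define s where "s = p + q"
  define e where "e = degree r"
  define N where "N = degree q"
  have r: "lead_coeff r \<noteq> 0" using \<open>p \<noteq> q\<close> by (simp add: r_def del: coeff_diff)
  have s: "degree s \<le> N" "coeff s N = 2"
    using p q deg by (auto simp: s_def N_def intro: degree_add_le)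
  have "degree r \<le> N" "coeff r N = 0"
    using p q deg by (auto simp: r_def N_def intro: degree_diff_le)
  then have e: "e < N" using r unfolding e_def by (metis le_neq_implies_less)
  have eq: "[:0, 1:] ^ 3 * euler_quadratic r s = euler_quartic r s"
    using kdv_bilinear_diff_euler[of p q] kp kq by (simp add: r_def s_def)
  \<comment> \<open>The index is the top possible degree on the left; the quartic side lacks the
    factor \<open>z^3\<close> and ends at \<open>e + N\<close>.\<close>
  have "coeff ([:0, 1:] ^ 3 * euler_quadratic r s) (e + N + 3)
      = (of_nat N - of_nat e) ^ 2 * lead_coeff r * 2"
    using coeff_euler_quadratic[of r e s N] s unfolding coeff_X_power_mult by (simp add: e_def)
  moreover have "coeff (euler_quartic r s) (e + N + 3) = 0"
    using degree_euler_quartic[of r e s N] s by (intro coeff_eq_0) (auto simp: e_def)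
  moreover have "of_nat N - of_nat e \<noteq> (0 :: 'a)" using e by simp
  ultimately show False using r eq by simp
qed

section \<open>Vanishing of the constant of integration\<close>

lemma degree_kdv_bilinear:
  fixes p :: "'a::{idom, ring_char_0} poly"
  assumes "kdv_bilinear p \<noteq> 0"
  shows "degree (kdv_bilinear p) < 2 * degree p"
proof -
  let ?n = "degree p"
  have X: "degree ([:0, 1:] ^ k * r) = k + degree r" if "r \<noteq> 0" for k and r :: "'a poly"
    using that by (simp add: degree_mult_eq degree_power_eq)
  have "degree (2 * ([:0, 1:] ^ 4 * kdv_bilinear p)) = 4 + degree (kdv_bilinear p)"
    using assms X[OF assms, of 4] by (simp add: degree_mult_eq)
  moreover have "degree ([:0, 1:] ^ 3 * euler_quadratic p p - euler_quartic p p) \<le> 3 + 2 * ?n"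
  proof (rule degree_diff_le)
    show "degree ([:0, 1:] ^ 3 * euler_quadratic p p) \<le> 3 + 2 * ?n"
      using X[of "euler_quadratic p p" 3] degree_euler_quadratic[of p ?n p ?n]
      by (cases "euler_quadratic p p = 0") auto
    show "degree (euler_quartic p p) \<le> 3 + 2 * ?n"
      using degree_euler_quartic[of p ?n p ?n] by simp
  qed
  ultimately show ?thesis using kdv_bilinear_euler[of p] by simp
qed

text \<open>The hypothesis says that \<open>kdv_bilinear p / p ^ 2\<close> is constant. A nonzero
  constant would need numerator and denominator of equal degree, against
  \<open>degree_kdv_bilinear\<close>.\<close>

lemma kdv_bilinear_eq_0_if_pderiv:
  fixes p :: "'a::{idom, ring_char_0} poly"
  assumes "pderiv (kdv_bilinear p) * p = 2 * kdv_bilinear p * pderiv p"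
  shows "kdv_bilinear p = 0"
proof (rule ccontr)
  assume nz: "kdv_bilinear p \<noteq> 0"
  let ?t = "kdv_bilinear p"
  have p0: "p \<noteq> 0" using nz by (auto simp: kdv_bilinear_def)
  have 0: "euler_deriv 0 r = r" for r :: "'a poly" by (simp add: euler_deriv_def)
  have c: "coeff (euler_deriv k ?t * euler_deriv l p) (degree ?t + degree p)
      = coeff (euler_deriv k ?t) (degree ?t) * coeff (euler_deriv l p) (degree p)" for k l
    by (intro coeff_mult_add_bound degree_euler_deriv)
  \<comment> \<open>Multiplying by \<open>z\<close> lets the top coefficients be compared without an
    index shift.\<close>
  have "euler_deriv 1 ?t * euler_deriv 0 p = smult 2 (euler_deriv 0 ?t * euler_deriv 1 p)"
    using assms by (simp add: euler_deriv_def numeral_poly mult_ac)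
  from arg_cong[OF this, of "\<lambda>r. coeff r (degree ?t + degree p)"]
  have "of_nat (degree ?t) * (lead_coeff ?t * lead_coeff p)
      = of_nat (2 * degree p) * (lead_coeff ?t * lead_coeff p)"
    unfolding coeff_smult c coeff_euler_deriv_1 unfolding 0 by (simp add: mult_ac)
  then have "degree ?t = 2 * degree p"
    using nz p0 by (simp del: of_nat_mult)
  then show False using degree_kdv_bilinear[OF nz] by simp
qed

section \<open>From the KdV equation to the polynomial of the poles\<close>

lemma map_poly_of_real_simps:
  fixes p q :: "real poly"
  shows "map_poly complex_of_real (p + q) = map_poly of_real p + map_poly of_real q"
    and "map_poly complex_of_real (p - q) = map_poly of_real p - map_poly of_real q"
    and "map_poly complex_of_real (p * q) = map_poly of_real p * map_poly of_real q"
    and "map_poly complex_of_real (pderiv p) = pderiv (map_poly of_real p)"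
    and "map_poly complex_of_real (numeral k) = numeral k"
    and "map_poly complex_of_real (p ^ i) = map_poly of_real p ^ i"
    and "map_poly complex_of_real [:0, 1:] = [:0, 1:]"
proof -
  show mult: "map_poly complex_of_real (p * q) = map_poly of_real p * map_poly of_real q" for p q
    by (intro poly_eqI) (simp add: coeff_map_poly coeff_mult)
  show "map_poly complex_of_real (p ^ i) = map_poly of_real p ^ i"
    by (induction i) (simp_all add: mult)
  show "map_poly complex_of_real (pderiv p) = pderiv (map_poly of_real p)"
    by (intro poly_eqI) (simp add: coeff_map_poly coeff_pderiv)
qed (auto intro!: poly_eqI simp: coeff_map_poly coeff_pCons numeral_poly split: nat.splits)

lemma kdv_bilinear_map_poly_of_real:
  "kdv_bilinear (map_poly complex_of_real p) = map_poly of_real (kdv_bilinear p)"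
  unfolding kdv_bilinear_def map_poly_of_real_simps ..

lemma poly_map_poly_of_real:
  "poly (map_poly complex_of_real p) (of_real x) = of_real (poly p x)"
  by (induction p) (simp_all add: map_poly_pCons)

definition recip_sum :: "('i \<Rightarrow> complex) \<Rightarrow> 'i set \<Rightarrow> nat \<Rightarrow> complex \<Rightarrow> complex" where
  "recip_sum a I k x = (\<Sum>q\<in>I. 1 / (x - a q) ^ k)"

lemma recip_sum_deriv:
  assumes "x \<notin> a ` I"
  shows "(recip_sum a I k has_field_derivative - of_nat k * recip_sum a I (Suc k) x) (at x)"
proof -
  have cancel: "- (of_nat k * u ^ (k - 1)) / (u ^ k * u ^ k) = - of_nat k * (1 / u ^ Suc k)"
    if "u \<noteq> 0" for u :: complex
    using that by (cases k) (simp_all add: divide_simps)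
  have "((\<lambda>x. 1 / (x - a q) ^ k) has_field_derivative - of_nat k * (1 / (x - a q) ^ Suc k)) (at x)"
    if "q \<in> I" for q
  proof -
    have nz: "x - a q \<noteq> 0" using assms that by auto
    have "((\<lambda>x. 1 / (x - a q) ^ k) has_field_derivative
        - (of_nat k * (x - a q) ^ (k - 1)) / ((x - a q) ^ k * (x - a q) ^ k)) (at x)"
      using nz by (auto intro!: derivative_eq_intros)
    also have "- (of_nat k * (x - a q) ^ (k - 1)) / ((x - a q) ^ k * (x - a q) ^ k)
        = - of_nat k * (1 / (x - a q) ^ Suc k)"
      using cancel[OF nz] .
    finally show ?thesis .
  qed
  then have "((\<lambda>x. \<Sum>q\<in>I. 1 / (x - a q) ^ k) has_field_derivative
      (\<Sum>q\<in>I. - of_nat k * (1 / (x - a q) ^ Suc k))) (at x)"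
    by (rule DERIV_sum)
  then show ?thesis
    by (simp only: recip_sum_def[abs_def] sum_distrib_left)
qed

text \<open>Used to differentiate formulas for \<open>p\<close> that hold only away from the
  poles.\<close>

lemma poly_pderiv_eqI:
  fixes p :: "complex poly"
  assumes S: "open S" and eq: "\<And>x. x \<in> S \<Longrightarrow> poly p x = f x"
    and D: "\<And>x. x \<in> S \<Longrightarrow> (f has_field_derivative f' x) (at x)" and x: "x \<in> S"
  shows "poly (pderiv p) x = f' x"
proof -
  have "(poly p has_field_derivative f' x) (at x)"
    using has_field_derivative_transform_within_open[OF D[OF x] S x] eq by metis
  then show ?thesis using DERIV_unique poly_DERIV by blast
qed

text \<open>All derivatives of \<open>p\<close> divided by \<open>p\<close> are polynomials in the
  sums \<open>s k\<close>, since \<open>s 1\<close> is the logarithmic derivative. So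
  \<open>kdv_bilinear p / p ^ 2\<close> becomes a function \<open>G\<close> of these sums, and the
  hypothesis says \<open>G' = 0\<close>.\<close>

lemma kdv_bilinear_poles:
  fixes a :: "'i \<Rightarrow> complex"
  assumes I: "finite I"
    and kdv: "\<And>x. x \<notin> a ` I \<Longrightarrow> (\<Sum>q\<in>I. a q / (x - a q) ^ 3)
      = 36 * recip_sum a I 5 x - 36 * recip_sum a I 2 x * recip_sum a I 3 x"
  shows "kdv_bilinear (\<Prod>q\<in>I. [:- a q, 1:]) = 0"
proof -
  define p where "p = (\<Prod>q\<in>I. [:- a q, 1:])"
  define S where "S = - (a ` I)"
  define s where "s k = recip_sum a I k" for k
  have S: "open S" using I by (auto simp: S_def open_Compl finite_imp_closed)
  have p0: "p \<noteq> 0" using I by (simp add: p_def)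
  have nz: "poly p x \<noteq> 0" if "x \<in> S" for x
    using that I by (auto simp: p_def S_def poly_prod)
  have D: "(s k has_field_derivative - of_nat k * s (Suc k) x) (at x)" if "x \<in> S" for k x
    using recip_sum_deriv that by (auto simp: s_def S_def)
  have Dp: "(poly p has_field_derivative poly (pderiv p) x) (at x)" for x by (rule poly_DERIV)
  have p1: "poly (pderiv p) x = poly p x * s 1 x" if x: "x \<in> S" for x
  proof -
    have "poly (pderiv p) x = (\<Sum>q\<in>I. \<Prod>r\<in>I - {q}. x - a r)"
      by (simp add: p_def pderiv_prod poly_sum poly_prod pderiv_pCons)
    also have "\<dots> = (\<Sum>q\<in>I. poly p x * (1 / (x - a q)))"
    proof (rule sum.cong)
      fix q assume q: "q \<in> I"
      then have "poly p x = (x - a q) * (\<Prod>r\<in>I - {q}. x - a r)"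
        using I by (simp add: p_def poly_prod prod.remove left_diff_distrib)
      moreover have "x - a q \<noteq> 0" using x q by (auto simp: S_def)
      ultimately show "(\<Prod>r\<in>I - {q}. x - a r) = poly p x * (1 / (x - a q))" by simp
    qed simp
    finally show ?thesis by (simp add: s_def recip_sum_def sum_distrib_left)
  qed
  have p2: "poly (pderiv (pderiv p)) x = poly p x * (s 1 x ^ 2 - s 2 x)" if x: "x \<in> S" for x
    by (rule poly_pderiv_eqI[OF S p1 _ x], assumption,
      (rule derivative_eq_intros Dp D refl | assumption)+)
     (simp add: p1 algebra_simps power2_eq_square numeral_2_eq_2)
  have p3: "poly (pderiv (pderiv (pderiv p))) x = poly p x * (s 1 x ^ 3 - 3 * s 1 x * s 2 x + 2 * s 3 x)"
    if x: "x \<in> S" for x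
    by (rule poly_pderiv_eqI[OF S p2 _ x], assumption,
      (rule derivative_eq_intros Dp D refl | assumption)+)
     (simp add: p1 algebra_simps eval_nat_numeral)
  have p4: "poly (pderiv (pderiv (pderiv (pderiv p)))) x = poly p x *
      (s 1 x ^ 4 - 6 * s 1 x ^ 2 * s 2 x + 3 * s 2 x ^ 2 + 8 * s 1 x * s 3 x - 6 * s 4 x)"
    if x: "x \<in> S" for x
    by (rule poly_pderiv_eqI[OF S p3 _ x], assumption,
      (rule derivative_eq_intros Dp D refl | assumption)+)
     (simp add: p1 algebra_simps eval_nat_numeral)
  \<comment> \<open>the first integral of the similarity-reduced KdV equation\<close>
  define G where "G x = s 1 x - x * s 2 x - 18 * s 2 x ^ 2 + 18 * s 4 x" for x
  have t: "poly (kdv_bilinear p) x = poly p x ^ 2 * G x" if x: "x \<in> S" for x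
    unfolding kdv_bilinear_def G_def
    by (simp add: p1[OF x] p2[OF x] p3[OF x] p4[OF x]) algebra
  have DG: "(G has_field_derivative 0) (at x)" if x: "x \<in> S" for x
  proof -
    have D: "(G has_field_derivative
        - 2 * s 2 x + 2 * x * s 3 x + 72 * s 2 x * s 3 x - 72 * s 5 x) (at x)"
      unfolding G_def[abs_def]
      by ((rule derivative_eq_intros D[OF x] refl)+) (simp add: algebra_simps eval_nat_numeral)
    have "x * s 3 x - s 2 x = (\<Sum>q\<in>I. a q / (x - a q) ^ 3)"
      unfolding s_def recip_sum_def sum_distrib_left sum_subtractf[symmetric]
    proof (rule sum.cong)
      fix q assume "q \<in> I"
      then have "x - a q \<noteq> 0" using x by (auto simp: S_def)
      then show "x * (1 / (x - a q) ^ 3) - 1 / (x - a q) ^ 2 = a q / (x - a q) ^ 3"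
        by (simp add: divide_simps eval_nat_numeral)
    qed simp
    moreover have "(\<Sum>q\<in>I. a q / (x - a q) ^ 3) = 36 * s 5 x - 36 * s 2 x * s 3 x"
      using kdv[of x] x by (simp add: S_def s_def)
    ultimately have "- 2 * s 2 x + 2 * x * s 3 x + 72 * s 2 x * s 3 x - 72 * s 5 x = 0"
      by algebra
    with D show ?thesis by simp
  qed
  have t': "poly (pderiv (kdv_bilinear p)) x = 2 * poly p x * (poly p x * s 1 x) * G x"
    if x: "x \<in> S" for x
    by (rule poly_pderiv_eqI[OF S t _ x], assumption,
      (rule derivative_eq_intros Dp DG refl | assumption)+)
     (simp add: p1 algebra_simps)
  \<comment> \<open>The last factor \<open>p\<close> makes the identity trivial at the poles, so it
    holds everywhere and can be cancelled as an identity of polynomials.\<close>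
  have "poly ((pderiv (kdv_bilinear p) * p - 2 * kdv_bilinear p * pderiv p) * p) x = 0" for x
  proof (cases "x \<in> S")
    case True
    then show ?thesis by (simp add: t t' p1 power2_eq_square)
  next
    case False
    then have "poly p x = 0" using I by (auto simp: S_def p_def poly_prod)
    then show ?thesis by simp
  qed
  then have "(pderiv (kdv_bilinear p) * p - 2 * kdv_bilinear p * pderiv p) * p = 0"
    by (simp only: poly_all_0_iff_0[symmetric]) simp
  then have "pderiv (kdv_bilinear p) * p = 2 * kdv_bilinear p * pderiv p"
    using p0 by simp
  then show ?thesis unfolding p_def by (rule kdv_bilinear_eq_0_if_pderiv)
qed

text \<open>This is the KdV equation at time 1, where the poles are the \<open>a q\<close> and the
  cube root has derivative 1/3.\<close>

lemma kdv_solution_pole_identity: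
  fixes a :: "nat \<Rightarrow> complex" and u :: "complex \<Rightarrow> real \<Rightarrow> complex"
  assumes I: "finite I"
    and kdv: "kdv_solution_on {(x, t). \<forall>q\<in>I. x \<noteq> kdv_pole a q t} u"
    and form: "\<And>x t. \<forall>q\<in>I. x \<noteq> kdv_pole a q t \<Longrightarrow>
      u x t = 2 * (\<Sum>q\<in>I. 1 / (x - kdv_pole a q t) ^ 2)"
    and x: "x \<notin> a ` I"
  shows "(\<Sum>q\<in>I. a q / (x - a q) ^ 3)
      = 36 * recip_sum a I 5 x - 36 * recip_sum a I 2 x * recip_sum a I 3 x"
proof -
  define S where "S = - (a ` I)"
  define s where "s k = recip_sum a I k" for k
  have S: "open S" using I by (auto simp: S_def open_Compl finite_imp_closed)
  have D: "(s k has_field_derivative - of_nat k * s (Suc k) z) (at z)" if "z \<in> S" for k z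
    using recip_sum_deriv that by (auto simp: s_def S_def)
  have pole1: "kdv_pole a q 1 = a q" for q by (simp add: kdv_pole_def)
  obtain u_t u_x u_xx u_xxx where
    K: "\<And>x t. \<forall>q\<in>I. x \<noteq> kdv_pole a q t \<Longrightarrow>
        ((\<lambda>s. u x s) has_vector_derivative u_t x t) (at t) \<and>
        ((\<lambda>z. u z t) has_field_derivative u_x x t) (at x) \<and>
        ((\<lambda>z. u_x z t) has_field_derivative u_xx x t) (at x) \<and>
        ((\<lambda>z. u_xx z t) has_field_derivative u_xxx x t) (at x) \<and>
        u_t x t = 6 * u x t * u_x x t - u_xxx x t"
    using kdv unfolding kdv_solution_on_def by blast
  have inS: "\<forall>q\<in>I. z \<noteq> kdv_pole a q 1" if "z \<in> S" for z
    using that by (auto simp: pole1 S_def)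
  have u: "u z 1 = 2 * s 2 z" if "z \<in> S" for z
    using form[OF inS[OF that]] by (simp add: pole1 s_def recip_sum_def)
  have ux: "u_x z 1 = - 4 * s 3 z" if z: "z \<in> S" for z
  proof -
    have "((\<lambda>z. 2 * s 2 z) has_field_derivative - 4 * s 3 z) (at z)"
      by ((rule derivative_eq_intros D[OF z] refl)+) (simp add: eval_nat_numeral)
    then have "((\<lambda>z. u z 1) has_field_derivative - 4 * s 3 z) (at z)"
      by (rule has_field_derivative_transform_within_open[OF _ S z]) (simp add: u)
    then show ?thesis using K[OF inS[OF z]] DERIV_unique by blast
  qed
  have uxx: "u_xx z 1 = 12 * s 4 z" if z: "z \<in> S" for z
  proof -
    have "((\<lambda>z. - 4 * s 3 z) has_field_derivative 12 * s 4 z) (at z)"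
      by ((rule derivative_eq_intros D[OF z] refl)+) (simp add: eval_nat_numeral)
    then have "((\<lambda>z. u_x z 1) has_field_derivative 12 * s 4 z) (at z)"
      by (rule has_field_derivative_transform_within_open[OF _ S z]) (simp add: ux)
    then show ?thesis using K[OF inS[OF z]] DERIV_unique by blast
  qed
  have uxxx: "u_xxx z 1 = - 48 * s 5 z" if z: "z \<in> S" for z
  proof -
    have "((\<lambda>z. 12 * s 4 z) has_field_derivative - 48 * s 5 z) (at z)"
      by ((rule derivative_eq_intros D[OF z] refl)+) (simp add: eval_nat_numeral)
    then have "((\<lambda>z. u_xx z 1) has_field_derivative - 48 * s 5 z) (at z)"
      by (rule has_field_derivative_transform_within_open[OF _ S z]) (simp add: uxx)
    then show ?thesis using K[OF inS[OF z]] DERIV_unique by blast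
  qed
  have xS: "x \<in> S" using x by (simp add: S_def)
  have cont: "isCont (\<lambda>t. kdv_pole a q t) 1" for q
    unfolding kdv_pole_def by (intro continuous_intros)
  \<comment> \<open>The poles move continuously, so the fixed \<open>x\<close> avoids them for
    \<open>t\<close> near 1 and the sum formula may be differentiated in \<open>t\<close>.\<close>
  have "eventually (\<lambda>t. \<forall>q\<in>I. x \<noteq> kdv_pole a q t) (nhds 1)"
  proof (intro eventually_ball_finite I ballI)
    fix q assume "q \<in> I"
    then have ne: "kdv_pole a q 1 \<noteq> x" using inS[OF xS] by blast
    have lim: "((\<lambda>t. kdv_pole a q t) \<longlongrightarrow> kdv_pole a q 1) (nhds 1)"
      using cont[of q] by (simp add: isCont_def tendsto_at_iff_tendsto_nhds)
    show "eventually (\<lambda>t. x \<noteq> kdv_pole a q t) (nhds 1)"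
      using tendsto_imp_eventually_ne[OF lim ne] by (rule eventually_mono) auto
  qed
  then obtain T where T: "open T" "1 \<in> T"
    and out: "\<And>t. t \<in> T \<Longrightarrow> \<forall>q\<in>I. x \<noteq> kdv_pole a q t"
    unfolding eventually_nhds by blast
  have root: "(root 3 has_real_derivative 1 / 3) (at 1)"
    using DERIV_real_root[of 3 1] by simp
  have "((\<lambda>t. 1 / (x - kdv_pole a q t) ^ 2) has_vector_derivative 2 / 3 * (a q / (x - a q) ^ 3)) (at 1)"
    if q: "q \<in> I" for q
  proof -
    have nz: "x - a q \<noteq> 0" using q x by auto
    have "((\<lambda>z. 1 / (x - a q * z) ^ 2) has_field_derivative 2 * (a q / (x - a q) ^ 3))
        (at (complex_of_real (root 3 1)))"
      using nz by (auto intro!: derivative_eq_intros simp: divide_simps eval_nat_numeral)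
    moreover have "((\<lambda>t. complex_of_real (root 3 t)) has_vector_derivative of_real (1 / 3)) (at 1)"
      by (rule has_vector_derivative_of_real) (use root in \<open>simp add: has_real_derivative_iff_has_vector_derivative\<close>)
    ultimately have "((\<lambda>z. 1 / (x - a q * z) ^ 2) \<circ> (\<lambda>t. complex_of_real (root 3 t))
        has_vector_derivative of_real (1 / 3) * (2 * (a q / (x - a q) ^ 3))) (at 1)"
      by (intro field_vector_diff_chain_at)
    then show ?thesis by (simp add: o_def kdv_pole_def mult_ac)
  qed
  then have "((\<lambda>t. 2 * (\<Sum>q\<in>I. 1 / (x - kdv_pole a q t) ^ 2)) has_vector_derivative
      2 * (\<Sum>q\<in>I. 2 / 3 * (a q / (x - a q) ^ 3))) (at 1)"
    by (intro has_vector_derivative_mult_right has_vector_derivative_sum)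
  then have "((\<lambda>t. u x t) has_vector_derivative 2 * (\<Sum>q\<in>I. 2 / 3 * (a q / (x - a q) ^ 3))) (at 1)"
    using T by (rule has_vector_derivative_transform_within_open) (simp add: form[OF out])
  then have "u_t x 1 = 2 * (\<Sum>q\<in>I. 2 / 3 * (a q / (x - a q) ^ 3))"
    using K[OF inS[OF xS]] vector_derivative_unique_at by blast
  moreover have "u_t x 1 = 6 * u x 1 * u_x x 1 - u_xxx x 1"
    using K[OF inS[OF xS]] by blast
  ultimately show ?thesis
    unfolding u[OF xS] ux[OF xS] uxxx[OF xS] s_def sum_distrib_left[symmetric]
    by (subst mult_left_cancel[of 4, symmetric]) (simp_all add: algebra_simps)
qed

lemma card_neg_pp_exponents: "card {k \<in> {0..n}. pp_exponent n k < 0} = (n + 1) div 2"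
proof -
  \<comment> \<open>For even \<open>n\<close> the index \<open>n / 2\<close> has exponent 0 and is
    not counted.\<close>
  have "{k \<in> {0..n}. pp_exponent n k < 0} = {..<(n + 1) div 2}"
    by (auto simp: pp_exponent_def)
  then show ?thesis by simp
qed


theorem mainTheorem3:
  fixes n :: nat
    and u :: "complex \<Rightarrow> real \<Rightarrow> complex"
    and a :: "nat \<Rightarrow> complex"
  assumes n: "n \<ge> 1"
    and kdv: "kdv_solution_on {(x, t). \<forall>q\<in>{1..n * (n + 1) div 2}. x \<noteq> kdv_pole a q t} u"
    and initial: "\<And>x. x \<noteq> 0 \<Longrightarrow> u x 0 = of_nat (n * (n + 1)) / x ^ 2"
    and form: "\<And>x t. \<forall>q\<in>{1..n * (n + 1) div 2}. x \<noteq> kdv_pole a q t \<Longrightarrow>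
      u x t = 2 * (\<Sum>q=1..n * (n + 1) div 2. 1 / (x - kdv_pole a q t) ^ 2)"
  shows "card {q \<in> {1..n * (n + 1) div 2}. \<forall>t. t \<noteq> 0 \<longrightarrow> kdv_pole a q t \<in> \<real>} = (n + 1) div 2 \<and>
    (\<forall>t. t \<noteq> 0 \<longrightarrow> card {q \<in> {1..n * (n + 1) div 2}. kdv_pole a q t \<in> \<real>} = (n + 1) div 2) \<and>
    card {q \<in> {1..n * (n + 1) div 2}. a q \<in> \<real>} = (n + 1) div 2 \<and>
    card {q \<in> {1..n * (n + 1) div 2}. a q \<in> \<real>} = card {k \<in> {0..n}. pp_exponent n k < 0}"
proof -
  define I where "I = {1..n * (n + 1) div 2}"
  define p where "p = (\<Prod>q\<in>I. [:- a q, 1:])"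
  have I: "finite I" "card I = triangular n" by (simp_all add: I_def triangular_def)
  have "kdv_bilinear p = 0"
    unfolding p_def
  proof (intro kdv_bilinear_poles I)
    fix x assume x: "x \<notin> a ` I"
    show "(\<Sum>q\<in>I. a q / (x - a q) ^ 3)
        = 36 * recip_sum a I 5 x - 36 * recip_sum a I 2 x * recip_sum a I 3 x"
      by (rule kdv_solution_pole_identity[OF I(1) kdv[folded I_def] form[folded I_def] x])
  qed
  obtain f :: "real poly" where f: "lead_coeff f = 1" "degree f = triangular n"
    "coprime f (pderiv f)" "kdv_bilinear f = 0" "card {x. poly f x = 0} = (n + 1) div 2"
    using tau_pair_exists[of n] by blast
  have p: "lead_coeff p = 1" "degree p = triangular n"
  proof -
    show "lead_coeff p = 1" unfolding p_def lead_coeff_prod by simp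
    show "degree p = triangular n" unfolding p_def using I by (simp add: degree_prod_eq_sum_degree)
  qed
  \<comment> \<open>Uniqueness identifies the polynomial of the complex poles with the real
    polynomial whose real roots are already counted.\<close>
  have pf: "p = map_poly of_real f"
  proof (rule kdv_bilinear_unique)
    show "lead_coeff (map_poly complex_of_real f) = 1"
      using f(1) by (simp add: coeff_map_poly degree_map_poly)
    show "degree p = degree (map_poly complex_of_real f)"
      using f p by (simp add: degree_map_poly)
    show "kdv_bilinear (map_poly complex_of_real f) = 0"
      by (simp add: kdv_bilinear_map_poly_of_real f)
  qed fact+
  have root: "poly p z = 0 \<longleftrightarrow> z \<in> a ` I" for z
    using I by (auto simp: p_def poly_prod)
  \<comment> \<open>Counting indices agrees with counting roots only if no value repeats. A repeated
    one would be a double root of \<open>p\<close>, excluded by transferring the Bezout identity for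
    \<open>f\<close> and \<open>pderiv f\<close> to the complex numbers.\<close>
  have inj: "inj_on a I"
  proof (rule inj_onI, rule ccontr)
    fix q r assume qr: "q \<in> I" "r \<in> I" "a q = a r" "q \<noteq> r"
    define L where "L = [:- a q, 1:]"
    have "p = L * (L * (\<Prod>i\<in>I - {q} - {r}. [:- a i, 1:]))"
      unfolding p_def L_def using qr I
      by (simp only: prod.remove[of I q] prod.remove[of "I - {q}" r] finite_Diff Diff_iff singleton_iff simp_thms)
    moreover have "poly L (a q) = 0" by (simp add: L_def)
    ultimately have "poly p (a q) = 0" "poly (pderiv p) (a q) = 0"
      by (simp_all add: pderiv_mult)
    moreover obtain c d where "c * f + d * pderiv f = 1"
      using f(3) using bezout_coefficients_fst_snd[of f "pderiv f"] by (auto simp: coprime_iff_gcd_eq_1)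
    from arg_cong[OF this, of "map_poly complex_of_real"]
    have "map_poly of_real c * p + map_poly of_real d * pderiv p = 1"
      by (simp add: map_poly_of_real_simps pf)
    from arg_cong[OF this, of "\<lambda>r. poly r (a q)"]
    have "poly (map_poly of_real c) (a q) * poly p (a q)
        + poly (map_poly of_real d) (a q) * poly (pderiv p) (a q) = 1" by simp
    ultimately show False by simp
  qed
  have "card {q \<in> I. a q \<in> \<real>} = card (a ` {q \<in> I. a q \<in> \<real>})"
    using inj by (intro card_image[symmetric]) (auto intro: inj_on_subset)
  also have "a ` {q \<in> I. a q \<in> \<real>} = complex_of_real ` {x. poly f x = 0}"
  proof -
    have *: "complex_of_real x \<in> a ` I \<longleftrightarrow> poly f x = 0" for x
      unfolding root[symmetric] pf poly_map_poly_of_real by simp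
    have "B \<inter> \<real> = complex_of_real ` {x. complex_of_real x \<in> B}" for B
      by (auto simp: Reals_def)
    moreover have "a ` {q \<in> I. a q \<in> \<real>} = a ` I \<inter> \<real>" by auto
    ultimately show ?thesis by (simp only: *)
  qed
  also have "card \<dots> = (n + 1) div 2"
    using f(5) by (subst card_image) (auto intro: inj_onI)
  finally have card: "card {q \<in> I. a q \<in> \<real>} = (n + 1) div 2" .
  have real: "kdv_pole a q t \<in> \<real> \<longleftrightarrow> a q \<in> \<real>" if "t \<noteq> 0" for q t
  proof
    assume "kdv_pole a q t \<in> \<real>"
    then have "kdv_pole a q t / complex_of_real (root 3 t) \<in> \<real>" by (intro Reals_divide) auto
    then show "a q \<in> \<real>" using that by (simp add: kdv_pole_def)
  qed (simp add: kdv_pole_def)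
  have "{q \<in> I. \<forall>t. t \<noteq> 0 \<longrightarrow> kdv_pole a q t \<in> \<real>} = {q \<in> I. a q \<in> \<real>}"
    using real zero_neq_one by blast
  moreover have "{q \<in> I. kdv_pole a q t \<in> \<real>} = {q \<in> I. a q \<in> \<real>}" if "t \<noteq> 0" for t
    using real[OF that] by blast
  ultimately show ?thesis
    using card card_neg_pp_exponents[of n] unfolding I_def by simp
qed

end
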